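(* Assume that $\mathbb{S}(I)$ contains the identity map $\mathrm{id}_I$, and let $f,g\in T_{\mathbb{S}(I)}(X,\mathcal{P})$. Then $(f,g)\in \mathcal{L}$ in $T_{\mathbb{S}(I)}(X,\mathcal{P})$ if and only if there exist $\alpha,\beta\in \mathbb{S}(I)$ such that: (i) $\chi^{(f)}=\alpha\chi^{(g)}$ and $\chi^{(g)}=\beta\chi^{(f)}$; and (ii) $X_if\subseteq X_{i\alpha}g$ and $X_ig\subseteq X_{i\beta}f$ for all $i\in I$.
   Context: $X$ is a nonempty set (possibly infinite) and $\mathcal{P}=\{X_i : i\in I\}$ is a partition of $X$ into nonempty blocks, with $X_i\cap X_j=\varnothing$ for $i\neq j$. $T(Z)$ denotes the semigroup of all maps $Z\to Z$ under composition. Maps are written on the right and composed from left to right: $x(fg)=(xf)g$; $Af=\{af: a\in A\}$. $T(X,\mathcal{P})$ is the subsemigroup of all $f\in T(X)$ such that for every $i\in I$ there is $j\in I$ with $X_if\subseteq X_j$. For $f\in T(X,\mathcal{P})$ the character $\chi^{(f)}\in T(I)$ is defined by $i\chi^{(f)}=j$ whenever $X_if\subseteq X_j$. For a subsemigroup $\mathbb{S}(I)$ of $T(I)$, $T_{\mathbb{S}(I)}(X,\mathcal{P})=\{f\in T(X,\mathcal{P}): \chi^{(f)}\in \mathbb{S}(I)\}$, a subsemigroup of $T(X,\mathcal{P})$; it contains $\mathrm{id}_X$ iff $\mathrm{id}_I\in\mathbb{S}(I)$. In a semigroup $S$ with identity, Green's relation $\mathcal{L}$ is: $(a,b)\in\mathcal{L}$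 iff $Sa=Sb$. *)

theory Defs
  imports "HOL-Algebra.Coset" "HOL-Library.Disjoint_Sets"
begin

text \<open>The full transformation monoid \<open>T(Z)\<close> on a set \<open>Z\<close>. Self-maps of \<open>Z\<close> are extensional
  functions. Maps act on the right, so a product \<open>f \<otimes> g\<close> means ``first \<open>f\<close>, then \<open>g\<close>'':
  \<open>x(fg) = (xf)g\<close>.\<close>

definition full_transf :: "'z set \<Rightarrow> ('z \<Rightarrow> 'z) monoid"
  where "full_transf Z =
    \<lparr>carrier = Z \<rightarrow>\<^sub>E Z,
     mult = (\<lambda>f g. compose Z g f),
     one = (\<lambda>x\<in>Z. x)\<rparr>"

definition subsemigroup :: "'a set \<Rightarrow> ('a, 'm) monoid_scheme \<Rightarrow> bool"
  where "subsemigroup H G \<longleftrightarrow>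
    H \<noteq> {} \<and> H \<subseteq> carrier G \<and> (\<forall>a\<in>H. \<forall>b\<in>H. a \<otimes>\<^bsub>G\<^esub> b \<in> H)"

text \<open>\<open>(B i)\<close>, \<open>i \<in> I\<close>, are the blocks of a partition of \<open>X\<close>.\<close>

definition indexed_partition :: "'x set \<Rightarrow> 'i set \<Rightarrow> ('i \<Rightarrow> 'x set) \<Rightarrow> bool"
  where "indexed_partition X I B \<longleftrightarrow>
    (\<forall>i\<in>I. B i \<noteq> {}) \<and> disjoint_family_on B I \<and> (\<Union>i\<in>I. B i) = X"

definition block_maps :: "'x set \<Rightarrow> 'i set \<Rightarrow> ('i \<Rightarrow> 'x set) \<Rightarrow> ('x \<Rightarrow> 'x) set"
  where "block_maps X I B =
    {f \<in> carrier (full_transf X). \<forall>i\<in>I. \<exists>j\<in>I. f ` B i \<subseteq> B j}"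

text \<open>The character of \<open>f\<close>. For an indexed partition and \<open>f \<in> block_maps X I B\<close> the \<open>j\<close> below
  exists and is unique, because the blocks are nonempty and pairwise disjoint.\<close>

definition character :: "'i set \<Rightarrow> ('i \<Rightarrow> 'x set) \<Rightarrow> ('x \<Rightarrow> 'x) \<Rightarrow> 'i \<Rightarrow> 'i"
  where "character I B f = (\<lambda>i\<in>I. THE j. j \<in> I \<and> f ` B i \<subseteq> B j)"

definition char_transf ::
    "'x set \<Rightarrow> 'i set \<Rightarrow> ('i \<Rightarrow> 'x set) \<Rightarrow> ('i \<Rightarrow> 'i) set \<Rightarrow> ('x \<Rightarrow> 'x) monoid"
  where "char_transf X I B S =
    (full_transf X)\<lparr>carrier := {f \<in> block_maps X I B. character I B f \<in> S}\<rparr>"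

text \<open>Green's relation \<open>\<L>\<close> in a semigroup \<open>S\<close> with identity: \<open>Sa = Sb\<close>.
  The set \<open>Sa\<close> is the library's \<open>carrier S #>\<^bsub>S\<^esub> a\<close>.\<close>

definition green_L :: "('a, 'm) monoid_scheme \<Rightarrow> 'a rel"
  where "green_L S =
    {(a, b). a \<in> carrier S \<and> b \<in> carrier S \<and> carrier S #>\<^bsub>S\<^esub> a = carrier S #>\<^bsub>S\<^esub> b}"

end

theory Submission
  imports Defs
begin

text \<open>In a monoid \<open>M\<close> one has \<open>Ma = Mb\<close> iff \<open>a \<in> Mb\<close> and \<open>b \<in> Ma\<close>, so everything comes down to
  deciding when \<open>f = hg\<close> is solvable for \<open>h\<close> among the block maps with character in \<open>S\<close>
  (lemma \<open>mem_left_multiples_iff\<close>).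

  If \<open>f = hg\<close>, then the character \<open>\<alpha>\<close> of \<open>h\<close> works: characters are multiplicative, and \<open>h\<close> sends
  \<open>B i\<close> into \<open>B (\<alpha> i)\<close>, so \<open>f\<close> sends \<open>B i\<close> into the \<open>g\<close>-image of \<open>B (\<alpha> i)\<close>. Conversely, let
  \<open>f ` B i \<subseteq> g ` B (\<alpha> i)\<close> for all \<open>i\<close>. Choosing for every \<open>x \<in> B i\<close> a \<open>g\<close>-preimage of \<open>f x\<close> inside
  \<open>B (\<alpha> i)\<close> yields a solution \<open>h\<close>; the restriction on where the preimages lie forces \<open>h\<close> to be a
  block map with character exactly \<open>\<alpha>\<close>. Since distinct blocks are disjoint, the choices for
  different \<open>i\<close> do not interfere.\<close>

lemma full_transf_simps [simp]:
  "carrier (full_transf Z) = Z \<rightarrow>\<^sub>E Z"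
  "a \<otimes>\<^bsub>full_transf Z\<^esub> b = compose Z b a"
  "\<one>\<^bsub>full_transf Z\<^esub> = (\<lambda>x\<in>Z. x)"
  by (simp_all add: full_transf_def)

lemma char_transf_simps [simp]:
  "carrier (char_transf X I B S) = {f \<in> block_maps X I B. character I B f \<in> S}"
  "a \<otimes>\<^bsub>char_transf X I B S\<^esub> b = compose X b a"
  "\<one>\<^bsub>char_transf X I B S\<^esub> = (\<lambda>x\<in>X. x)"
  by (simp_all add: char_transf_def full_transf_def)

lemma block_subset:
  assumes "indexed_partition X I B" "i \<in> I"
  shows "B i \<subseteq> X"
  using assms by (auto simp: indexed_partition_def)

lemma block_unique:
  assumes "indexed_partition X I B" "i \<in> I" "j \<in> I" "x \<in> B i" "x \<in> B j"
  shows "i = j"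
  using assms by (auto simp: indexed_partition_def disjoint_family_on_def)

text \<open>Nonemptiness of the blocks is what makes the character well defined here: an empty \<open>B i\<close>
  would have its image contained in every block.\<close>

lemma character_eqI:
  assumes P: "indexed_partition X I B" and "i \<in> I" "j \<in> I" "f ` B i \<subseteq> B j"
  shows "character I B f i = j"
proof -
  obtain x where x: "x \<in> B i"
    using P \<open>i \<in> I\<close> by (auto simp: indexed_partition_def)
  have "(THE j. j \<in> I \<and> f ` B i \<subseteq> B j) = j"
  proof (rule the_equality)
    fix k assume k: "k \<in> I \<and> f ` B i \<subseteq> B k"
    then have "f x \<in> B k" "f x \<in> B j" using x assms(4) by auto
    with k show "k = j" using block_unique[OF P] assms(3) by blast
  qed (use assms in blast)
  then show ?thesis using \<open>i \<in> I\<close> by (simp add: character_def)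
qed

lemma character_extensional: "character I B f \<in> extensional I"
  by (simp add: character_def)

lemma character_block:
  assumes P: "indexed_partition X I B" and "f \<in> block_maps X I B" "i \<in> I"
  shows "character I B f i \<in> I" "f ` B i \<subseteq> B (character I B f i)"
proof -
  obtain j where "j \<in> I" "f ` B i \<subseteq> B j"
    using assms by (auto simp: block_maps_def)
  with character_eqI[OF P \<open>i \<in> I\<close> this]
  show "character I B f i \<in> I" "f ` B i \<subseteq> B (character I B f i)" by simp_all
qed

lemma compose_image:
  assumes "A \<subseteq> X"
  shows "compose X g f ` A = g ` f ` A"
  using assms by (force simp: compose_def image_image)

lemma compose_block_map:
  assumes P: "indexed_partition X I B" and f: "f \<in> block_maps X I B" and g: "g \<in> block_maps X I B"
  shows "compose X g f \<in> block_maps X I B"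
    and "character I B (compose X g f) = compose I (character I B g) (character I B f)"
proof -
  let ?k = "\<lambda>i. character I B g (character I B f i)"
  have k: "?k i \<in> I" "compose X g f ` B i \<subseteq> B (?k i)" if i: "i \<in> I" for i
  proof -
    note fi = character_block[OF P f i]
    note gi = character_block[OF P g fi(1)]
    show "?k i \<in> I" by (fact gi(1))
    show "compose X g f ` B i \<subseteq> B (?k i)"
      unfolding compose_image[OF block_subset[OF P i]] using fi(2) gi(2) by blast
  qed
  have "compose X g f \<in> X \<rightarrow>\<^sub>E X"
    using f g by (auto simp: block_maps_def PiE_iff compose_def)
  then show "compose X g f \<in> block_maps X I B"
    unfolding block_maps_def full_transf_simps using k by blast
  show "character I B (compose X g f) = compose I (character I B g) (character I B f)"
  proof (rule extensionalityI[OF character_extensional compose_extensional])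
    fix i assume i: "i \<in> I"
    show "character I B (compose X g f) i =
        compose I (character I B g) (character I B f) i"
      using character_eqI[OF P i k(1)[OF i] k(2)[OF i]] i by (simp add: compose_eq)
  qed
qed

lemma identity_block_map:
  assumes P: "indexed_partition X I B"
  shows "(\<lambda>x\<in>X. x) \<in> block_maps X I B" and "character I B (\<lambda>x\<in>X. x) = (\<lambda>i\<in>I. i)"
proof -
  have id: "(\<lambda>x\<in>X. x) ` B i \<subseteq> B i" if "i \<in> I" for i
    using block_subset[OF P that] by auto
  then show "(\<lambda>x\<in>X. x) \<in> block_maps X I B" by (auto simp: block_maps_def)
  show "character I B (\<lambda>x\<in>X. x) = (\<lambda>i\<in>I. i)"
  proof (rule extensionalityI[OF character_extensional restrict_extensional])
    fix i assume "i \<in> I"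
    then show "character I B (\<lambda>x\<in>X. x) i = (\<lambda>i\<in>I. i) i"
      using character_eqI[OF P _ _ id[of i]] by (simp only: restrict_apply')
  qed
qed

lemma monoid_char_transf:
  assumes P: "indexed_partition X I B"
    and "subsemigroup S (full_transf I)" "\<one>\<^bsub>full_transf I\<^esub> \<in> S"
  shows "monoid (char_transf X I B S)"
proof (rule monoidI)
  fix f g assume "f \<in> carrier (char_transf X I B S)" "g \<in> carrier (char_transf X I B S)"
  then show "f \<otimes>\<^bsub>char_transf X I B S\<^esub> g \<in> carrier (char_transf X I B S)"
    using assms compose_block_map[OF P] by (simp add: subsemigroup_def)
next
  show "\<one>\<^bsub>char_transf X I B S\<^esub> \<in> carrier (char_transf X I B S)"
    using assms identity_block_map[OF P] by simp
next
  fix f g h assume "f \<in> carrier (char_transf X I B S)"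
  then have "f \<in> X \<rightarrow> X" by (auto simp: block_maps_def)
  then show "f \<otimes>\<^bsub>char_transf X I B S\<^esub> g \<otimes>\<^bsub>char_transf X I B S\<^esub> h =
      f \<otimes>\<^bsub>char_transf X I B S\<^esub> (g \<otimes>\<^bsub>char_transf X I B S\<^esub> h)"
    by (simp add: compose_assoc)
next
  fix f assume "f \<in> carrier (char_transf X I B S)"
  then have "f \<in> X \<rightarrow> X" "f \<in> extensional X" by (auto simp: block_maps_def PiE_iff)
  then show "\<one>\<^bsub>char_transf X I B S\<^esub> \<otimes>\<^bsub>char_transf X I B S\<^esub> f = f"
    and "f \<otimes>\<^bsub>char_transf X I B S\<^esub> \<one>\<^bsub>char_transf X I B S\<^esub> = f"
    by (simp_all add: Id_compose compose_Id)
qed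

lemma (in monoid) left_multiples_eq_iff:
  assumes a: "a \<in> carrier G" and b: "b \<in> carrier G"
  shows "carrier G #> a = carrier G #> b \<longleftrightarrow> a \<in> carrier G #> b \<and> b \<in> carrier G #> a"
proof -
  have self: "c \<in> carrier G #> c" if "c \<in> carrier G" for c
    unfolding r_coset_def using that by (intro UN_I[of \<one>]) simp_all
  have sub: "carrier G #> c \<subseteq> carrier G #> d" if c: "c \<in> carrier G #> d" and d: "d \<in> carrier G" for c d
  proof -
    obtain h where h: "h \<in> carrier G" "c = h \<otimes> d"
      using c by (auto simp: r_coset_def)
    have "k \<otimes> c = (k \<otimes> h) \<otimes> d" if "k \<in> carrier G" for k
      using that h d by (simp add: m_assoc)
    then show ?thesis using h(1) unfolding r_coset_def by fastforce
  qed
  show ?thesis using self[OF a] self[OF b] sub a b by blast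
qed

text \<open>On each block \<open>B i\<close> the map \<open>f\<close> factors through the restriction of \<open>g\<close> to \<open>B (\<alpha> i)\<close>, by
  choice of preimages. As the blocks partition \<open>X\<close>, these local factorizations glue.\<close>

lemma factor_through_blocks:
  assumes P: "indexed_partition X I B" and \<alpha>: "\<alpha> \<in> I \<rightarrow>\<^sub>E I"
    and f: "f \<in> extensional X" and sub: "\<forall>i\<in>I. f ` B i \<subseteq> g ` B (\<alpha> i)"
  obtains h where "h \<in> block_maps X I B" "character I B h = \<alpha>" "f = compose X g h"
proof -
  have "\<exists>y. \<forall>i\<in>I. x \<in> B i \<longrightarrow> y \<in> B (\<alpha> i) \<and> g y = f x" if x: "x \<in> X" for x
  proof -
    obtain i where i: "i \<in> I" "x \<in> B i"
      using P x by (auto simp: indexed_partition_def)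
    then have "f x \<in> g ` B (\<alpha> i)" using sub by blast
    then obtain y where "y \<in> B (\<alpha> i)" "g y = f x" by auto
    then show ?thesis using block_unique[OF P _ i(1) _ i(2)] by blast
  qed
  then obtain h where h: "\<And>x i. x \<in> X \<Longrightarrow> i \<in> I \<Longrightarrow> x \<in> B i \<Longrightarrow> h x \<in> B (\<alpha> i) \<and> g (h x) = f x"
    by metis
  let ?h = "restrict h X"
  have \<alpha>I: "\<alpha> i \<in> I" if "i \<in> I" for i using \<alpha> that by auto
  have img: "?h ` B i \<subseteq> B (\<alpha> i)" if "i \<in> I" for i
    using h that block_subset[OF P that] by auto
  have cover: "\<exists>i\<in>I. x \<in> B i" if "x \<in> X" for x
    using P that by (auto simp: indexed_partition_def)
  have "h x \<in> X" if x: "x \<in> X" for x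
    using cover[OF x] h[OF x] \<alpha>I block_subset[OF P] by blast
  then have bm: "?h \<in> block_maps X I B"
    unfolding block_maps_def full_transf_simps
    using restrict_PiE_iff[of h X "\<lambda>_. X"] img \<alpha>I by blast
  have ch: "character I B ?h = \<alpha>"
  proof (rule extensionalityI[of _ I])
    fix i assume i: "i \<in> I"
    show "character I B ?h i = \<alpha> i"
      by (rule character_eqI[OF P i \<alpha>I[OF i] img[OF i]])
  qed (use \<alpha> character_extensional in \<open>auto simp: PiE_iff\<close>)
  have "f = compose X g ?h"
  proof (rule extensionalityI[OF f compose_extensional])
    fix x assume x: "x \<in> X"
    then show "f x = compose X g ?h x"
      using cover[OF x] h[OF x] by (auto simp: compose_eq)
  qed
  with bm ch show thesis by (rule that)
qed

lemma mem_left_multiples_iff: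
  assumes P: "indexed_partition X I B" and S: "S \<subseteq> I \<rightarrow>\<^sub>E I"
    and f: "f \<in> extensional X" and g: "g \<in> block_maps X I B"
  shows "f \<in> carrier (char_transf X I B S) #>\<^bsub>char_transf X I B S\<^esub> g \<longleftrightarrow>
    (\<exists>\<alpha>\<in>S. character I B f = \<alpha> \<otimes>\<^bsub>full_transf I\<^esub> character I B g \<and>
      (\<forall>i\<in>I. f ` B i \<subseteq> g ` B (\<alpha> i)))"
    (is "?L \<longleftrightarrow> ?R")
proof
  assume ?L
  then obtain h where h: "h \<in> block_maps X I B" "character I B h \<in> S" "f = compose X g h"
    by (auto simp: r_coset_def)
  have "f ` B i \<subseteq> g ` B (character I B h i)" if i: "i \<in> I" for i
  proof -
    have "f ` B i = g ` h ` B i"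
      using compose_image[OF block_subset[OF P i]] h(3) by metis
    then show ?thesis
      using image_mono[OF character_block(2)[OF P h(1) i], of g] by simp
  qed
  moreover have "character I B f = character I B h \<otimes>\<^bsub>full_transf I\<^esub> character I B g"
    using compose_block_map(2)[OF P h(1) g] h(3) by simp
  ultimately show ?R using h(2) by blast
next
  assume ?R
  then obtain \<alpha> where \<alpha>: "\<alpha> \<in> S" "\<forall>i\<in>I. f ` B i \<subseteq> g ` B (\<alpha> i)" by blast
  have self_map: "\<alpha> \<in> I \<rightarrow>\<^sub>E I" using S \<alpha>(1) by blast
  obtain h where "h \<in> block_maps X I B" "character I B h = \<alpha>" "f = compose X g h"
    by (rule factor_through_blocks[OF P self_map f \<alpha>(2)])
  then show ?L using \<alpha>(1) by (auto simp: r_coset_def)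
qed

theorem theorem5p3:
  fixes X :: "'x set" and I :: "'i set" and B :: "'i \<Rightarrow> 'x set"
    and S :: "('i \<Rightarrow> 'i) set" and f g :: "'x \<Rightarrow> 'x"
  assumes "X \<noteq> {}"
    and "indexed_partition X I B"
    and "subsemigroup S (full_transf I)"
    and "\<one>\<^bsub>full_transf I\<^esub> \<in> S"
    and "f \<in> carrier (char_transf X I B S)"
    and "g \<in> carrier (char_transf X I B S)"
  shows "(f, g) \<in> green_L (char_transf X I B S) \<longleftrightarrow>
    (\<exists>\<alpha>\<in>S. \<exists>\<beta>\<in>S.
      (character I B f = \<alpha> \<otimes>\<^bsub>full_transf I\<^esub> character I B g \<and>
       character I B g = \<beta> \<otimes>\<^bsub>full_transf I\<^esub> character I B f) \<and>
      (\<forall>i\<in>I. f ` B i \<subseteq> g ` B (\<alpha> i) \<and> g ` B i \<subseteq> f ` B (\<beta> i)))"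
proof -
  let ?M = "char_transf X I B S"
  interpret M: monoid ?M by (rule monoid_char_transf) fact+
  have S: "S \<subseteq> I \<rightarrow>\<^sub>E I" using assms(3) by (simp add: subsemigroup_def)
  have f: "f \<in> block_maps X I B" "f \<in> extensional X"
    and g: "g \<in> block_maps X I B" "g \<in> extensional X"
    using assms(5,6) by (auto simp: block_maps_def PiE_iff)
  have "(f, g) \<in> green_L ?M \<longleftrightarrow>
      f \<in> carrier ?M #>\<^bsub>?M\<^esub> g \<and> g \<in> carrier ?M #>\<^bsub>?M\<^esub> f"
    unfolding green_L_def using M.left_multiples_eq_iff[OF assms(5,6)] assms(5,6) by blast
  then show ?thesis
    unfolding mem_left_multiples_iff[OF assms(2) S f(2) g(1)]
      mem_left_multiples_iff[OF assms(2) S g(2) f(1)] ball_conj_distrib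
    by meson
qed

end
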